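(* Let $q>2$ and $k>t\ge 0$ be integers. Then there is $n_0=n_0(q,k,t)$ such that for all $n\ge n_0$, $\mathcal A'_q(t,k,n)$ is, up to equivalence, the unique maximum size anticode of length $n$, constant weight $k$ and diameter $2(k-t)$ over $\mathbb Z_q$; that is, it has the maximum size among all $(n,2(k-t),k)_q$ anticodes, and every $(n,2(k-t),k)_q$ anticode of this maximum size is equivalent to $\mathcal A'_q(t,k,n)$.
   Context: $\mathbb Z_q=\{0,1,\dots,q-1\}$ is the alphabet. The Hamming distance of two words of the same length over $\mathbb Z_q$ is the number of coordinates in which they differ; the weight $\mathrm{wt}(x)$ of a word $x$ is the number of its nonzero entries. An $(n,D,k)_q$ anticode is a set of words of length $n$ and weight $k$ over $\mathbb Z_q$ whose diameter (the maximum Hamming distance between two of its words) is $D$. $\mathcal A'_q(t,k,n)$ is the set of all words of length $n$ over $\mathbb Z_q$ of the form $(1,\dots,1,b_1,\dots,b_{n-t})$, starting with $t$ ones, where $b_i\in\mathbb Z_q$ and $\mathrm{wt}(b_1,\dots,b_{n-t})=k-t$. Two sets of words of length $n$ and constant weight $k$ over $\mathbb Z_q$ are equivalent if one is obtained from the other by a permutation of the $n$ coordinates together with, in each coordinate separately, a permutation of the symbols of $\mathbb Z_q$ fixing $0$. *)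

theory Defs
  imports "HOL-Combinatorics.Permutations"
begin

definition words :: "nat \<Rightarrow> nat \<Rightarrow> nat list set" where
  "words q n = {x. length x = n \<and> set x \<subseteq> {..<q}}"

text \<open>Hamming distance, meant for two words of the same length.\<close>

definition hamming_dist :: "nat list \<Rightarrow> nat list \<Rightarrow> nat" where
  "hamming_dist x y = card {i. i < length x \<and> x ! i \<noteq> y ! i}"

definition wt :: "nat list \<Rightarrow> nat" where
  "wt x = card {i. i < length x \<and> x ! i \<noteq> 0}"

definition diameter :: "nat list set \<Rightarrow> nat" where
  "diameter A = Max {hamming_dist x y | x y. x \<in> A \<and> y \<in> A}"

text \<open>The diameter is exactly \<open>D\<close>, not just bounded by \<open>D\<close>. The empty set, on which
  \<^const>\<open>Max\<close> is unspecified, has no diameter and is excluded.\<close>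

definition anticode :: "nat \<Rightarrow> nat \<Rightarrow> nat \<Rightarrow> nat \<Rightarrow> nat list set \<Rightarrow> bool" where
  "anticode q n D k A \<longleftrightarrow>
     A \<subseteq> {x \<in> words q n. wt x = k} \<and> A \<noteq> {} \<and> diameter A = D"

definition star_anticode :: "nat \<Rightarrow> nat \<Rightarrow> nat \<Rightarrow> nat \<Rightarrow> nat list set" where
  "star_anticode q t k n = {x \<in> words q n. \<exists>b. x = replicate t 1 @ b \<and> wt b = k - t}"

definition code_equiv :: "nat \<Rightarrow> nat \<Rightarrow> nat list set \<Rightarrow> nat list set \<Rightarrow> bool" where
  "code_equiv q n A B \<longleftrightarrow>
     (\<exists>\<pi> \<sigma>. \<pi> permutes {..<n} \<and>
        (\<forall>i<n. \<sigma> i permutes {..<q} \<and> \<sigma> i 0 = 0) \<and>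
        B = (\<lambda>x. map (\<lambda>i. \<sigma> i (x ! \<pi> i)) [0..<n]) ` A)"

end

theory Submission
  imports Defs "HOL-Library.FuncSet"
begin

text \<open>
  For words \<open>x\<close>, \<open>y\<close> of weight \<open>k\<close> the distance is \<open>2 * k - s - a\<close>, where \<open>s\<close> is the number of
  common support positions and \<open>a \<le> s\<close> is the number of those at which the words agree. Diameter
  at most \<open>2 * (k - t)\<close> thus means \<open>s + a \<ge> 2 * t\<close>; in particular \<open>s \<ge> t\<close>, and \<open>s = t\<close> forces the
  words to agree on their whole common support. In the form used below
  (\<open>agree_or_common_position\<close>): for every \<open>t\<close>-set \<open>T\<close> of positions, either \<open>x\<close> and \<open>y\<close> agree on \<open>T\<close>,
  or their supports share a position outside \<open>T\<close>.

  Fix a word \<open>x\<close> of the anticode. If for some \<open>t\<close>-subset \<open>T\<close> of its support all words agree with \<open>x\<close>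
  on \<open>T\<close>, then a permutation of coordinates and symbols embeds the anticode into the star \<open>star_anticode q t k n\<close>
  (\<open>code_equiv_if_common_values\<close>), which gives both the bound and the equality case. Otherwise
  each such \<open>T\<close> has a witness \<open>y\<close> that disagrees with \<open>x\<close> somewhere on \<open>T\<close>. Every word \<open>z\<close> contains
  some such \<open>T\<close> in its support, and \<open>z\<close> disagrees on \<open>T\<close> with \<open>x\<close> or with \<open>y\<close>, so it has a further
  support position in the support of \<open>x\<close> or of \<open>y\<close>. All words then have one of boundedly many
  \<open>(t + 1)\<close>-sets in their support (\<open>card_le_if_no_common_values\<close>). For fixed \<open>q\<close>, \<open>k\<close>, \<open>t\<close> this leaves
  only order \<open>n ^ (k - t - 1)\<close> words, whereas the star has order \<open>n ^ (k - t)\<close>.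
\<close>

section \<open>Supports and the distance of two words\<close>

definition supp :: "nat list \<Rightarrow> nat set" where
  "supp x = {i. i < length x \<and> x ! i \<noteq> 0}"

definition const_weight_words :: "nat \<Rightarrow> nat \<Rightarrow> nat \<Rightarrow> nat list set" where
  "const_weight_words q n k = {x \<in> words q n. wt x = k}"

lemma finite_supp [simp]: "finite (supp x)"
  by (simp add: supp_def)

lemma card_supp: "card (supp x) = wt x"
  by (simp add: supp_def wt_def)

lemma const_weight_wordsD:
  assumes "x \<in> const_weight_words q n k"
  shows "length x = n" "wt x = k" "card (supp x) = k" "supp x \<subseteq> {..<n}"
    "\<And>i. i < n \<Longrightarrow> x ! i < q"
  using assms
  by (simp_all add: const_weight_words_def words_def card_supp)
    (auto simp: supp_def subset_iff)

lemma finite_const_weight_words [simp]: "finite (const_weight_words q n k)"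
proof -
  have "finite {x. set x \<subseteq> {..<q} \<and> length x = n}"
    by (rule finite_lists_length_eq) simp
  then show ?thesis
    by (rule rev_finite_subset) (auto simp: const_weight_words_def words_def)
qed

text \<open>Both sides count a position of exactly one support once and a common support position twice:
  on the left the second count comes from the distance if the symbols differ there, and from the
  agreement set if they are equal.\<close>

lemma hamming_dist_plus_common_support:
  assumes "length x = length y"
  shows "hamming_dist x y + card (supp x \<inter> supp y) + card {i \<in> supp x \<inter> supp y. x ! i = y ! i}
    = wt x + wt y"
proof -
  let ?D = "{i. i < length x \<and> x ! i \<noteq> y ! i}"
  let ?E = "{i \<in> supp x \<inter> supp y. x ! i = y ! i}"
  have "supp x \<union> supp y = ?D \<union> ?E"
    using assms by (auto simp: supp_def)
  moreover have "card (?D \<union> ?E) = card ?D + card ?E"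
    by (rule card_Un_disjoint) auto
  moreover have "card (supp x) + card (supp y) = card (supp x \<union> supp y) + card (supp x \<inter> supp y)"
    by (rule card_Un_Int) auto
  ultimately show ?thesis
    by (simp add: hamming_dist_def card_supp)
qed

lemma finite_hamming_dists:
  assumes "finite A"
  shows "finite {hamming_dist x y | x y. x \<in> A \<and> y \<in> A}"
proof -
  have "{hamming_dist x y | x y. x \<in> A \<and> y \<in> A} = (\<lambda>(x, y). hamming_dist x y) ` (A \<times> A)"
    by auto
  then show ?thesis
    using assms by simp
qed

lemma anticode_hamming_dist_le:
  assumes "anticode q n D k A" "x \<in> A" "y \<in> A"
  shows "hamming_dist x y \<le> D"
proof -
  have "finite A"
    using assms(1) finite_subset[OF _ finite_const_weight_words]
    by (auto simp: anticode_def const_weight_words_def)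
  then have "hamming_dist x y \<le> diameter A"
    unfolding diameter_def using assms(2,3) by (intro Max_ge finite_hamming_dists) auto
  then show ?thesis
    using assms(1) by (simp add: anticode_def)
qed

section \<open>Two words within distance \<open>2 * (k - t)\<close>\<close>

text \<open>The agreement set lies in the common support, so half of the required total \<open>2 * t\<close> must
  already come from the latter.\<close>

lemma card_common_support_ge:
  assumes "x \<in> const_weight_words q n k" "y \<in> const_weight_words q n k"
    and "hamming_dist x y \<le> 2 * (k - t)" "t \<le> k"
  shows "t \<le> card (supp x \<inter> supp y)"
    and "2 * t \<le> card (supp x \<inter> supp y) + card {i \<in> supp x \<inter> supp y. x ! i = y ! i}"
proof -
  note D = const_weight_wordsD[OF assms(1)] const_weight_wordsD[OF assms(2)]
  show 2: "2 * t \<le> card (supp x \<inter> supp y) + card {i \<in> supp x \<inter> supp y. x ! i = y ! i}"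
    using hamming_dist_plus_common_support[of x y] D assms(3,4) by simp
  have "card {i \<in> supp x \<inter> supp y. x ! i = y ! i} \<le> card (supp x \<inter> supp y)"
    by (rule card_mono) auto
  then show "t \<le> card (supp x \<inter> supp y)"
    using 2 by simp
qed

text \<open>If the common support is confined to \<open>T\<close>, then it has at most \<open>t\<close> elements, and the total
  \<open>2 * t\<close> can only be reached if it equals \<open>T\<close> and the words agree on all of it.\<close>

lemma agree_or_common_position:
  assumes "x \<in> const_weight_words q n k" "y \<in> const_weight_words q n k"
    and "hamming_dist x y \<le> 2 * (k - t)" "t \<le> k"
    and "finite T" "card T = t"
  shows "(\<forall>i\<in>T. x ! i = y ! i) \<or> (\<exists>e. e \<in> supp x \<inter> supp y - T)"
proof (rule disjCI)
  let ?E = "{i \<in> supp x \<inter> supp y. x ! i = y ! i}"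
  assume "\<not> (\<exists>e. e \<in> supp x \<inter> supp y - T)"
  then have sub: "supp x \<inter> supp y \<subseteq> T"
    by blast
  then have "card (supp x \<inter> supp y) \<le> t"
    using assms(5,6) card_mono by metis
  moreover have "?E \<subseteq> T"
    using sub by blast
  moreover have "card ?E \<le> card T"
    using \<open>?E \<subseteq> T\<close> assms(5) by (intro card_mono) auto
  ultimately have "?E = T"
    using card_common_support_ge(2)[OF assms(1-4)] assms(5,6) by (intro card_subset_eq) auto
  then show "\<forall>i\<in>T. x ! i = y ! i"
    by blast
qed

section \<open>Counting words whose support contains a given set\<close>

definition indicator_word :: "nat \<Rightarrow> nat set \<Rightarrow> nat list" where
  "indicator_word n S = map (\<lambda>i. if i \<in> S then 1 else 0) [0..<n]"

lemma supp_indicator_word: "S \<subseteq> {..<n} \<Longrightarrow> supp (indicator_word n S) = S"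
  by (auto simp: supp_def indicator_word_def split: if_splits)

lemma indicator_word_in_const_weight_words:
  assumes "S \<subseteq> {..<n}" "card S = k" "q > 1"
  shows "indicator_word n S \<in> const_weight_words q n k"
proof -
  have "wt (indicator_word n S) = k"
    using assms by (simp add: supp_indicator_word flip: card_supp)
  moreover have "indicator_word n S \<in> words q n"
    using assms(3) by (auto simp: words_def indicator_word_def)
  ultimately show ?thesis
    by (simp add: const_weight_words_def)
qed

lemma card_supersets_of_card:
  assumes "U \<subseteq> V" "finite V" "card U \<le> k"
  shows "card {S. U \<subseteq> S \<and> S \<subseteq> V \<and> card S = k} = (card V - card U) choose (k - card U)"
proof -
  have fin: "finite U"
    using assms finite_subset by blast
  have "bij_betw (\<lambda>R. U \<union> R) {R. R \<subseteq> V - U \<and> card R = k - card U}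
    {S. U \<subseteq> S \<and> S \<subseteq> V \<and> card S = k}"
  proof (rule bij_betw_byWitness[where f' = "\<lambda>S. S - U"])
    show "(\<union>) U ` {R. R \<subseteq> V - U \<and> card R = k - card U} \<subseteq> {S. U \<subseteq> S \<and> S \<subseteq> V \<and> card S = k}"
    proof clarify
      fix R assume R: "R \<subseteq> V - U" "card R = k - card U"
      have "finite R"
        using R(1) assms(2) finite_subset by blast
      then have "card (U \<union> R) = card U + card R"
        using R(1) fin by (intro card_Un_disjoint) auto
      then show "U \<subseteq> U \<union> R \<and> U \<union> R \<subseteq> V \<and> card (U \<union> R) = k"
        using R assms by auto
    qed
    show "(\<lambda>S. S - U) ` {S. U \<subseteq> S \<and> S \<subseteq> V \<and> card S = k} \<subseteq> {R. R \<subseteq> V - U \<and> card R = k - card U}"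
      using fin by (auto simp: card_Diff_subset)
  qed auto
  then have "card {S. U \<subseteq> S \<and> S \<subseteq> V \<and> card S = k} = card {R. R \<subseteq> V - U \<and> card R = k - card U}"
    by (simp add: bij_betw_same_card)
  also have "\<dots> = card (V - U) choose (k - card U)"
    using assms by (intro n_subsets) auto
  finally show ?thesis
    using assms fin by (simp add: card_Diff_subset)
qed

lemma card_words_with_support_le:
  assumes "card S = k" "finite S"
  shows "card {x \<in> const_weight_words q n k. supp x = S} \<le> q ^ k"
proof -
  let ?W = "{x \<in> const_weight_words q n k. supp x = S}"
  let ?r = "\<lambda>x. restrict ((!) x) S"
  have "inj_on ?r ?W"
  proof (rule inj_onI)
    fix x y assume x: "x \<in> ?W" and y: "y \<in> ?W" and eq: "?r x = ?r y"
    show "x = y"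
    proof (rule nth_equalityI)
      show len: "length x = length y"
        using x y const_weight_wordsD(1)[of x q n k] const_weight_wordsD(1)[of y q n k] by simp
      show "x ! i = y ! i" if i: "i < length x" for i
      proof (cases "i \<in> S")
        case True
        then show ?thesis
          using fun_cong[OF eq, of i] by simp
      next
        case False
        then have "i \<notin> supp x" "i \<notin> supp y"
          using x y by simp_all
        then show ?thesis
          using i len by (simp add: supp_def)
      qed
    qed
  qed
  moreover have "?r ` ?W \<subseteq> S \<rightarrow>\<^sub>E {..<q}"
  proof (rule image_subsetI)
    fix x assume "x \<in> ?W"
    then show "?r x \<in> S \<rightarrow>\<^sub>E {..<q}"
      using const_weight_wordsD(4,5)[of x q n k] by auto
  qed
  ultimately have "card ?W \<le> card (S \<rightarrow>\<^sub>E {..<q})"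
    using assms(2) by (intro card_inj_on_le[of ?r]) (auto intro: finite_PiE)
  also have "\<dots> = q ^ k"
    using assms by (simp add: card_PiE)
  finally show ?thesis .
qed

lemma card_words_with_support_superset_le:
  assumes "U \<subseteq> {..<n}" "card U \<le> k"
  shows "card {x \<in> const_weight_words q n k. U \<subseteq> supp x}
    \<le> ((n - card U) choose (k - card U)) * q ^ k"
proof -
  let ?\<S> = "{S. U \<subseteq> S \<and> S \<subseteq> {..<n} \<and> card S = k}"
  have fin: "finite ?\<S>"
    by (rule finite_subset[of _ "Pow {..<n}"]) auto
  have "{x \<in> const_weight_words q n k. U \<subseteq> supp x}
    \<subseteq> (\<Union>S\<in>?\<S>. {x \<in> const_weight_words q n k. supp x = S})"
  proof
    fix x assume x: "x \<in> {x \<in> const_weight_words q n k. U \<subseteq> supp x}"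
    then have "supp x \<in> ?\<S>"
      using const_weight_wordsD(3,4)[of x q n k] by simp
    then show "x \<in> (\<Union>S\<in>?\<S>. {x \<in> const_weight_words q n k. supp x = S})"
      using x by blast
  qed
  then have "card {x \<in> const_weight_words q n k. U \<subseteq> supp x}
    \<le> card (\<Union>S\<in>?\<S>. {x \<in> const_weight_words q n k. supp x = S})"
    using fin by (intro card_mono) auto
  also have "\<dots> \<le> (\<Sum>S\<in>?\<S>. card {x \<in> const_weight_words q n k. supp x = S})"
    using fin by (rule card_UN_le)
  also have "\<dots> \<le> card ?\<S> * q ^ k"
  proof -
    have "(\<Sum>S\<in>?\<S>. card {x \<in> const_weight_words q n k. supp x = S}) \<le> of_nat (card ?\<S>) * q ^ k"
      by (rule sum_bounded_above, rule card_words_with_support_le) (auto intro: finite_subset)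
    then show ?thesis
      by simp
  qed
  also have "card ?\<S> = (n - card U) choose (k - card U)"
    using card_supersets_of_card[OF assms(1) _ assms(2)] by simp
  finally show ?thesis .
qed

section \<open>The star\<close>

lemma star_anticode_iff:
  assumes "t \<le> n" "t \<le> k"
  shows "x \<in> star_anticode q t k n \<longleftrightarrow> x \<in> const_weight_words q n k \<and> (\<forall>i<t. x ! i = 1)"
proof -
  have wt_append: "wt (replicate t 1 @ b) = t + wt b" for b
  proof -
    have "supp (replicate t 1 @ b) = {..<t} \<union> (+) t ` supp b"
    proof (intro equalityI subsetI)
      fix i assume i: "i \<in> supp (replicate t 1 @ b)"
      show "i \<in> {..<t} \<union> (+) t ` supp b"
      proof (cases "i < t")
        case False
        then have "i - t \<in> supp b" "i = t + (i - t)"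
          using i by (auto simp: supp_def nth_append)
        then show ?thesis
          by blast
      qed simp
    qed (auto simp: supp_def nth_append)
    moreover have "card ({..<t} \<union> (+) t ` supp b) = card {..<t} + card ((+) t ` supp b)"
      by (rule card_Un_disjoint) auto
    ultimately show ?thesis
      by (simp add: card_image flip: card_supp)
  qed
  have split: "x = replicate t 1 @ drop t x" if "length x = n" "\<forall>i<t. x ! i = 1"
  proof -
    have "take t x = replicate t 1"
      using that assms by (intro nth_equalityI) auto
    then show ?thesis
      by (metis append_take_drop_id)
  qed
  show ?thesis
  proof
    assume "x \<in> star_anticode q t k n"
    then obtain b where b: "x \<in> words q n" "x = replicate t 1 @ b" "wt b = k - t"
      by (auto simp: star_anticode_def)
    have "wt x = k"
      unfolding b(2) wt_append b(3) using assms(2) by simp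
    moreover have "\<forall>i<t. x ! i = 1"
      by (simp add: b(2) nth_append)
    ultimately show "x \<in> const_weight_words q n k \<and> (\<forall>i<t. x ! i = 1)"
      using b(1) by (simp add: const_weight_words_def)
  next
    assume x: "x \<in> const_weight_words q n k \<and> (\<forall>i<t. x ! i = 1)"
    then have eq: "x = replicate t 1 @ drop t x"
      using split const_weight_wordsD(1) by blast
    then have "wt (drop t x) = k - t"
      using wt_append[of "drop t x"] x const_weight_wordsD(2) by force
    then show "x \<in> star_anticode q t k n"
      using eq x unfolding star_anticode_def const_weight_words_def by blast
  qed
qed

lemma indicator_word_in_star_anticode:
  assumes "S \<subseteq> {..<n}" "card S = k" "{..<t} \<subseteq> S" "q > 1"
  shows "indicator_word n S \<in> star_anticode q t k n"
proof -
  have "t \<le> k"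
    using card_mono[OF _ assms(3)] assms(1,2) finite_subset by fastforce
  moreover have "t \<le> n"
    using assms(1,3) by (meson lessThan_subset_iff order_trans)
  moreover have "\<forall>i<t. indicator_word n S ! i = 1"
    using assms(3) \<open>t \<le> n\<close> by (auto simp: indicator_word_def)
  ultimately show ?thesis
    using indicator_word_in_const_weight_words[OF assms(1,2,4)] by (simp add: star_anticode_iff)
qed

lemma finite_star_anticode:
  assumes "t \<le> n" "t \<le> k"
  shows "finite (star_anticode q t k n)"
  by (rule finite_subset[OF _ finite_const_weight_words[of q n k]])
    (use assms star_anticode_iff in blast)

text \<open>Counting only the 0/1-words of the star is enough, because the competing families are smaller
  by a factor of order \<open>n\<close>.\<close>

lemma card_star_anticode_ge:
  assumes "t \<le> n" "t \<le> k" "q > 1"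
  shows "(n - t) choose (k - t) \<le> card (star_anticode q t k n)"
proof -
  let ?\<S> = "{S. {..<t} \<subseteq> S \<and> S \<subseteq> {..<n} \<and> card S = k}"
  have "(n - t) choose (k - t) = card ?\<S>"
    using card_supersets_of_card[of "{..<t}" "{..<n}" k] assms by simp
  also have "\<dots> \<le> card (star_anticode q t k n)"
  proof (rule card_inj_on_le)
    show "inj_on (indicator_word n) ?\<S>"
      by (rule inj_on_inverseI[where g = supp]) (auto simp: supp_indicator_word)
    show "indicator_word n ` ?\<S> \<subseteq> star_anticode q t k n"
      using indicator_word_in_star_anticode assms(3) by blast
    show "finite (star_anticode q t k n)"
      using assms finite_star_anticode by blast
  qed
  finally show ?thesis .
qed

text \<open>The bound holds because any two words share the initial block of ones, which counts both as
  common support and as agreement. It is attained by two 0/1-words whose supports meet only in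
  that block.\<close>

lemma anticode_star_anticode:
  assumes "t \<le> k" "2 * k \<le> n" "q > 1"
  shows "anticode q n (2 * (k - t)) k (star_anticode q t k n)"
proof -
  let ?A = "star_anticode q t k n"
  have star: "x \<in> ?A \<longleftrightarrow> x \<in> const_weight_words q n k \<and> (\<forall>i<t. x ! i = 1)" for x
    using assms by (intro star_anticode_iff) auto
  let ?S = "{..<k}" and ?T = "{..<t} \<union> {k..<2 * k - t}"
  have T: "card ?T = k"
    using assms by (subst card_Un_disjoint) auto
  have subs: "?S \<subseteq> {..<n}" "?T \<subseteq> {..<n}"
    using assms by auto
  let ?u = "indicator_word n ?S" and ?v = "indicator_word n ?T"
  have uv: "?u \<in> ?A" "?v \<in> ?A"
    using assms T subs by (auto intro!: indicator_word_in_star_anticode)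
  have common: "?S \<inter> ?T = {..<t}"
    using assms by auto
  have agree: "{i \<in> {..<t}. ?u ! i = ?v ! i} = {..<t}"
    using assms by (auto simp: indicator_word_def)
  have "length ?u = length ?v"
    by (simp add: indicator_word_def)
  from hamming_dist_plus_common_support[OF this]
  have "hamming_dist ?u ?v + card {..<t} + card {..<t} = card ?S + card ?T"
    unfolding card_supp[symmetric] supp_indicator_word[OF subs(1)] supp_indicator_word[OF subs(2)]
      common agree .
  then have "hamming_dist ?u ?v + t + t = k + k"
    by (simp only: T card_lessThan)
  then have dist: "hamming_dist ?u ?v = 2 * (k - t)"
    using assms by simp
  have "diameter ?A = 2 * (k - t)"
    unfolding diameter_def
  proof (rule Max_eqI)
    show "finite {hamming_dist x y | x y. x \<in> ?A \<and> y \<in> ?A}"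
      using assms by (intro finite_hamming_dists finite_star_anticode) auto
    show "2 * (k - t) \<in> {hamming_dist x y | x y. x \<in> ?A \<and> y \<in> ?A}"
      using uv dist by force
  next
    fix d assume "d \<in> {hamming_dist x y | x y. x \<in> ?A \<and> y \<in> ?A}"
    then obtain x y where xy: "x \<in> ?A" "y \<in> ?A" and d: "d = hamming_dist x y"
      by blast
    note X = const_weight_wordsD[of x q n k] and Y = const_weight_wordsD[of y q n k]
    have x: "length x = n" "wt x = k" "\<forall>i<t. x ! i = 1"
      and y: "length y = n" "wt y = k" "\<forall>i<t. y ! i = 1"
      using X(1,2) Y(1,2) xy star by blast+
    let ?E = "{i \<in> supp x \<inter> supp y. x ! i = y ! i}"
    have "{..<t} \<subseteq> ?E"
      using x y assms by (auto simp: supp_def)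
    then have "t \<le> card ?E"
      using card_mono[of ?E "{..<t}"] by simp
    moreover have "card ?E \<le> card (supp x \<inter> supp y)"
      by (rule card_mono) auto
    ultimately show "d \<le> 2 * (k - t)"
      using hamming_dist_plus_common_support[of x y] x y assms d by simp
  qed
  then show ?thesis
    using uv star unfolding anticode_def const_weight_words_def by blast
qed

section \<open>Words with prescribed values on a set of positions\<close>

lemma permutes_image_initial_segment:
  assumes "T \<subseteq> {..<n}" "card T = t"
  obtains \<pi> where "\<pi> permutes {..<n}" "\<pi> ` {..<t} = T"
proof -
  have fin: "finite T"
    using assms(1) finite_subset by blast
  have le: "t \<le> n"
    using card_mono[OF _ assms(1)] assms(2) by simp
  obtain f where f: "bij_betw f {..<t} T"
    using finite_same_card_bij[of "{..<t}" T] fin assms(2) by auto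
  have "card ({..<n} - {..<t}) = card ({..<n} - T)"
    using assms fin le by (simp add: card_Diff_subset)
  then obtain g where g: "bij_betw g ({..<n} - {..<t}) ({..<n} - T)"
    using finite_same_card_bij[of "{..<n} - {..<t}" "{..<n} - T"] by auto
  define \<pi> where "\<pi> i = (if i < t then f i else if i < n then g i else i)" for i
  have 1: "bij_betw \<pi> {..<t} T"
    using f by (rule bij_betw_cong[THEN iffD1, rotated]) (auto simp: \<pi>_def)
  have 2: "bij_betw \<pi> ({..<n} - {..<t}) ({..<n} - T)"
    using g by (rule bij_betw_cong[THEN iffD1, rotated]) (auto simp: \<pi>_def)
  have "bij_betw \<pi> ({..<t} \<union> ({..<n} - {..<t})) (T \<union> ({..<n} - T))"
    by (rule bij_betw_combine[OF 1 2]) auto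
  moreover have "{..<t} \<union> ({..<n} - {..<t}) = {..<n}" "T \<union> ({..<n} - T) = {..<n}"
    using le assms(1) by auto
  ultimately have "bij_betw \<pi> {..<n} {..<n}"
    by simp
  then have "\<pi> permutes {..<n}"
    using le by (intro bij_imp_permutes) (auto simp: \<pi>_def)
  then show ?thesis
    using that 1 bij_betw_imp_surj_on by blast
qed

definition monomial_map :: "nat \<Rightarrow> (nat \<Rightarrow> nat) \<Rightarrow> (nat \<Rightarrow> nat \<Rightarrow> nat) \<Rightarrow> nat list \<Rightarrow> nat list" where
  "monomial_map n \<pi> \<sigma> x = map (\<lambda>i. \<sigma> i (x ! \<pi> i)) [0..<n]"

lemma monomial_map_in_const_weight_words:
  assumes \<pi>: "\<pi> permutes {..<n}"
    and \<sigma>: "\<And>i. i < n \<Longrightarrow> \<sigma> i permutes {..<q} \<and> \<sigma> i 0 = 0"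
    and x: "x \<in> const_weight_words q n k"
  shows "monomial_map n \<pi> \<sigma> x \<in> const_weight_words q n k"
proof -
  have \<pi>_less: "\<pi> i < n \<longleftrightarrow> i < n" for i
    using permutes_in_image[OF \<pi>, of i] by simp
  have zero_iff: "\<sigma> i a = 0 \<longleftrightarrow> a = 0" if "i < n" for i a
    using \<sigma>[OF that] permutes_inj[of "\<sigma> i" "{..<q}"] by (metis injD)
  have "supp x = \<pi> ` supp (monomial_map n \<pi> \<sigma> x)"
  proof -
    have "i \<in> supp (monomial_map n \<pi> \<sigma> x) \<longleftrightarrow> \<pi> i \<in> supp x" for i
      by (cases "i < n")
        (simp_all add: supp_def monomial_map_def const_weight_wordsD(1)[OF x] zero_iff \<pi>_less
          del: neq0_conv)
    then have "supp (monomial_map n \<pi> \<sigma> x) = \<pi> -` supp x"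
      by blast
    then show ?thesis
      using permutes_surj[OF \<pi>] by (simp add: surj_image_vimage_eq)
  qed
  then have "card (supp (monomial_map n \<pi> \<sigma> x)) = card (supp x)"
    using permutes_inj_on[OF \<pi>] by (simp add: card_image)
  moreover have "\<sigma> i (x ! \<pi> i) < q" if "i < n" for i
    using permutes_in_image[of "\<sigma> i" "{..<q}" "x ! \<pi> i"] \<sigma>[OF that] that \<pi>_less
      const_weight_wordsD(5)[OF x] by simp
  ultimately show ?thesis
    using const_weight_wordsD(2)[OF x]
    by (auto simp: const_weight_words_def words_def monomial_map_def card_supp)
qed

lemma inj_on_monomial_map:
  assumes \<pi>: "\<pi> permutes {..<n}"
    and \<sigma>: "\<And>i. i < n \<Longrightarrow> \<sigma> i permutes {..<q}"
  shows "inj_on (monomial_map n \<pi> \<sigma>) (const_weight_words q n k)"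
proof (rule inj_onI)
  fix x y
  assume x: "x \<in> const_weight_words q n k" and y: "y \<in> const_weight_words q n k"
    and eq: "monomial_map n \<pi> \<sigma> x = monomial_map n \<pi> \<sigma> y"
  note len = const_weight_wordsD(1)[OF x] const_weight_wordsD(1)[OF y]
  show "x = y"
  proof (rule nth_equalityI)
    show "length x = length y"
      using len by simp
    fix j assume "j < length x"
    then have "j \<in> \<pi> ` {..<n}"
      using len permutes_image[OF \<pi>] by simp
    then obtain i where i: "i < n" "j = \<pi> i"
      by auto
    have "\<sigma> i (x ! j) = \<sigma> i (y ! j)"
      using arg_cong[OF eq, of "\<lambda>z. z ! i"] i by (simp add: monomial_map_def)
    then show "x ! j = y ! j"
      using permutes_inj[OF \<sigma>[OF i(1)]] by (rule injD[rotated])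
  qed
qed

text \<open>Moving \<open>T\<close> to the front and exchanging the common value with \<open>1\<close> at each of its positions maps
  the family injectively into the star. Both conclusions follow, the second because an
  injection between finite sets of equal size is onto.\<close>

lemma code_equiv_if_common_values:
  assumes A: "A \<subseteq> const_weight_words q n k"
    and T: "T \<subseteq> {..<n}" "card T = t" "t \<le> k" and "q > 1"
    and c: "\<And>i. i \<in> T \<Longrightarrow> c i \<noteq> 0 \<and> c i < q"
    and common: "\<And>x i. x \<in> A \<Longrightarrow> i \<in> T \<Longrightarrow> x ! i = c i"
  shows "card A \<le> card (star_anticode q t k n)"
    and "card A = card (star_anticode q t k n) \<Longrightarrow> code_equiv q n A (star_anticode q t k n)"
proof -
  obtain \<pi> where \<pi>: "\<pi> permutes {..<n}" "\<pi> ` {..<t} = T"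
    using permutes_image_initial_segment[OF T(1,2)] by blast
  define \<sigma> where "\<sigma> i = (if i < t then transpose (c (\<pi> i)) 1 else id)" for i
  have \<sigma>: "\<sigma> i permutes {..<q} \<and> \<sigma> i 0 = 0" for i
  proof (cases "i < t")
    case True
    then have "\<pi> i \<in> T"
      using \<pi>(2) by blast
    then have c': "c (\<pi> i) \<noteq> 0" "c (\<pi> i) < q"
      using c by blast+
    have "transpose (c (\<pi> i)) 1 permutes {..<q}"
      using c' \<open>q > 1\<close> by (intro permutes_swap_id) auto
    moreover have "transpose (c (\<pi> i)) 1 0 = 0"
      using c' by (simp add: transpose_def)
    ultimately show ?thesis
      using True by (simp add: \<sigma>_def)
  qed (simp add: \<sigma>_def permutes_id)
  have le: "t \<le> n"
    using card_mono[OF _ T(1)] T(2) by simp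
  have inj: "inj_on (monomial_map n \<pi> \<sigma>) A"
    using inj_on_subset[OF inj_on_monomial_map A] \<pi>(1) \<sigma> by blast
  have img: "monomial_map n \<pi> \<sigma> ` A \<subseteq> star_anticode q t k n"
  proof (rule image_subsetI)
    fix x assume x: "x \<in> A"
    have "monomial_map n \<pi> \<sigma> x ! i = 1" if "i < t" for i
    proof -
      have "x ! \<pi> i = c (\<pi> i)"
        using common x \<pi>(2) that by blast
      then show ?thesis
        using that le by (simp add: monomial_map_def \<sigma>_def)
    qed
    moreover have "monomial_map n \<pi> \<sigma> x \<in> const_weight_words q n k"
      using monomial_map_in_const_weight_words[OF \<pi>(1)] \<sigma> x A by blast
    ultimately show "monomial_map n \<pi> \<sigma> x \<in> star_anticode q t k n"
      using le T(3) by (simp add: star_anticode_iff)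
  qed
  have fin: "finite (star_anticode q t k n)"
    using le T(3) by (rule finite_star_anticode)
  show "card A \<le> card (star_anticode q t k n)"
    using inj img fin by (rule card_inj_on_le)
  assume "card A = card (star_anticode q t k n)"
  then have "star_anticode q t k n = monomial_map n \<pi> \<sigma> ` A"
    using card_subset_eq[OF fin img] card_image[OF inj] by simp
  then show "code_equiv q n A (star_anticode q t k n)"
    unfolding code_equiv_def monomial_map_def[abs_def] using \<pi>(1) \<sigma> by blast
qed

section \<open>Families without common values\<close>

text \<open>The factor \<open>2 ^ k * (2 * k)\<close> bounds the number of \<open>(t + 1)\<close>-sets needed to cover all
  supports: \<open>T\<close> ranges over subsets of one support, and the extra position over the union of two
  supports. A word \<open>z\<close> that contains \<open>T\<close> in its support cannot agree on \<open>T\<close> with both \<open>x\<close> and the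
  witness chosen for \<open>T\<close>, so the extra position exists by \<open>agree_or_common_position\<close>.\<close>

lemma card_le_if_no_common_values:
  assumes A: "A \<subseteq> const_weight_words q n k" and "x \<in> A" and "t < k"
    and dist: "\<And>y z. y \<in> A \<Longrightarrow> z \<in> A \<Longrightarrow> hamming_dist y z \<le> 2 * (k - t)"
    and no_common: "\<And>T. T \<subseteq> supp x \<Longrightarrow> card T = t \<Longrightarrow> \<exists>y\<in>A. \<exists>i\<in>T. y ! i \<noteq> x ! i"
  shows "card A \<le> 2 ^ k * (2 * k) * (((n - Suc t) choose (k - Suc t)) * q ^ k)"
proof -
  define \<T> where "\<T> = {T. T \<subseteq> supp x \<and> card T = t}"
  have "\<forall>T\<in>\<T>. \<exists>y. y \<in> A \<and> (\<exists>i\<in>T. y ! i \<noteq> x ! i)"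
    using no_common unfolding \<T>_def by blast
  then obtain w where w: "\<And>T. T \<in> \<T> \<Longrightarrow> w T \<in> A \<and> (\<exists>i\<in>T. w T ! i \<noteq> x ! i)"
    by metis
  note cw = subsetD[OF A]
  define E where "E T = (supp x \<union> supp (w T)) - T" for T
  define W where "W U = {z \<in> const_weight_words q n k. U \<subseteq> supp z}" for U
  let ?B = "((n - Suc t) choose (k - Suc t)) * q ^ k"
  have finT: "finite T" if "T \<in> \<T>" for T
    using that finite_subset[OF _ finite_supp[of x]] by (simp add: \<T>_def)
  have \<T>: "finite \<T>" "card \<T> \<le> 2 ^ k"
  proof -
    have "\<T> \<subseteq> Pow (supp x)"
      by (auto simp: \<T>_def)
    then show "finite \<T>" "card \<T> \<le> 2 ^ k"
      using card_mono[of "Pow (supp x)" \<T>] finite_subset[of \<T> "Pow (supp x)"]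
        const_weight_wordsD(3)[OF cw[OF \<open>x \<in> A\<close>]] by (auto simp: card_Pow)
  qed
  have cover: "A \<subseteq> (\<Union>(T, e)\<in>Sigma \<T> E. W (insert e T))"
  proof
    fix z assume z: "z \<in> A"
    have "t \<le> card (supp z \<inter> supp x)"
      using card_common_support_ge(1)[OF cw[OF z] cw[OF \<open>x \<in> A\<close>] dist[OF z \<open>x \<in> A\<close>]] \<open>t < k\<close> by simp
    then obtain T where T: "T \<subseteq> supp z \<inter> supp x" "card T = t"
      by (meson obtain_subset_with_card_n)
    then have T_in: "T \<in> \<T>"
      by (simp add: \<T>_def)
    have extra: "\<exists>e. e \<in> supp z \<inter> supp y - T" if "y \<in> A" "\<exists>i\<in>T. z ! i \<noteq> y ! i" for y
      using agree_or_common_position[OF cw[OF z] cw[OF that(1)] dist[OF z that(1)] _ finT[OF T_in] T(2)]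
        \<open>t < k\<close> that(2) by auto
    have "\<exists>e. e \<in> supp z \<inter> supp x - T \<or> e \<in> supp z \<inter> supp (w T) - T"
    proof (cases "\<exists>i\<in>T. z ! i \<noteq> x ! i")
      case True
      then show ?thesis
        using extra[OF \<open>x \<in> A\<close>] by blast
    next
      case False
      then have "\<exists>i\<in>T. z ! i \<noteq> w T ! i"
        using w[OF T_in] by metis
      then show ?thesis
        using extra w[OF T_in] by blast
    qed
    then obtain e where "e \<in> supp z" "e \<in> E T"
      by (auto simp: E_def)
    then have "(T, e) \<in> Sigma \<T> E" "z \<in> W (insert e T)"
      using T T_in cw[OF z] by (auto simp: W_def)
    then show "z \<in> (\<Union>(T, e)\<in>Sigma \<T> E. W (insert e T))"
      by blast
  qed
  have card_E: "card (E T) \<le> 2 * k" if "T \<in> \<T>" for T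
  proof -
    have "card (E T) \<le> card (supp x \<union> supp (w T))"
      by (rule card_mono) (auto simp: E_def)
    also have "\<dots> \<le> card (supp x) + card (supp (w T))"
      by (rule card_Un_le)
    also have "\<dots> = 2 * k"
      using const_weight_wordsD(3)[OF cw[OF \<open>x \<in> A\<close>]] const_weight_wordsD(3)[OF cw] w[OF that] by simp
    finally show ?thesis .
  qed
  have fin_E: "finite (E T)" for T
    by (simp add: E_def)
  have finS: "finite (Sigma \<T> E)"
    using \<T>(1) fin_E by blast
  have "card (Sigma \<T> E) = (\<Sum>T\<in>\<T>. card (E T))"
    using \<T>(1) fin_E by simp
  also have "\<dots> \<le> of_nat (card \<T>) * (2 * k)"
    using card_E by (rule sum_bounded_above)
  also have "\<dots> \<le> 2 ^ k * (2 * k)"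
    using \<T>(2) by simp
  finally have card_Sigma: "card (Sigma \<T> E) \<le> 2 ^ k * (2 * k)" .
  have card_W: "card (W (insert e T)) \<le> ?B" if "T \<in> \<T>" "e \<in> E T" for T e
  proof -
    have "supp x \<subseteq> {..<n}" "supp (w T) \<subseteq> {..<n}"
      using const_weight_wordsD(4)[OF cw] \<open>x \<in> A\<close> w[OF that(1)] by auto
    then have "insert e T \<subseteq> {..<n}"
      using that by (auto simp: \<T>_def E_def)
    moreover have "card (insert e T) = Suc t"
    proof -
      have "e \<notin> T" "card T = t"
        using that by (simp_all add: E_def \<T>_def)
      then show ?thesis
        using finT[OF that(1)] by simp
    qed
    ultimately show ?thesis
      using card_words_with_support_superset_le[of "insert e T" n k q] \<open>t < k\<close> by (simp add: W_def)
  qed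
  have "card A \<le> card (\<Union>(T, e)\<in>Sigma \<T> E. W (insert e T))"
    using cover finS by (intro card_mono) (auto simp: W_def)
  also have "\<dots> \<le> (\<Sum>(T, e)\<in>Sigma \<T> E. card (W (insert e T)))"
    using card_UN_le[OF finS, of "\<lambda>(T, e). W (insert e T)"] by (simp add: case_prod_unfold)
  also have "\<dots> \<le> of_nat (card (Sigma \<T> E)) * ?B"
    by (rule sum_bounded_above) (use card_W in auto)
  also have "\<dots> \<le> 2 ^ k * (2 * k) * ?B"
    using card_Sigma by (simp only: of_nat_id mult_le_mono1)
  finally show ?thesis .
qed

text \<open>The absorption identity \<open>(k - t) * C(n - t, k - t) = (n - t) * C(n - t - 1, k - t - 1)\<close>
  supplies the factor of order \<open>n\<close> by which the star wins.\<close>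

lemma mult_binomial_less:
  assumes "t < k" "k \<le> n" "t + k * M < n"
  shows "M * ((n - Suc t) choose (k - Suc t)) < (n - t) choose (k - t)"
proof -
  let ?b = "(n - Suc t) choose (k - Suc t)"
  have "(k - t) * ((n - t) choose (k - t)) = (n - t) * ?b"
    using times_binomial_minus1_eq[of "k - t" "n - t"] assms by simp
  moreover have "?b > 0"
    using assms by (simp add: zero_less_binomial_iff)
  moreover have "(k - t) * M < n - t"
  proof -
    have "(k - t) * M \<le> k * M"
      by simp
    then show ?thesis
      using assms(3) by linarith
  qed
  ultimately have "(k - t) * (M * ?b) < (k - t) * ((n - t) choose (k - t))"
    by (metis mult.assoc mult_less_mono1)
  then show ?thesis
    by simp
qed

theorem theorem9:
  fixes q k t :: nat
  assumes "q > 2" and "k > t"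
  shows "\<exists>n0. \<forall>n\<ge>n0.
    anticode q n (2 * (k - t)) k (star_anticode q t k n) \<and>
    (\<forall>A. anticode q n (2 * (k - t)) k A \<longrightarrow> card A \<le> card (star_anticode q t k n)) \<and>
    (\<forall>A. anticode q n (2 * (k - t)) k A \<and> card A = card (star_anticode q t k n) \<longrightarrow>
         code_equiv q n A (star_anticode q t k n))"
proof -
  define M where "M = 2 ^ k * (2 * k) * q ^ k"
  have main: "card A \<le> card (star_anticode q t k n) \<and>
      (card A = card (star_anticode q t k n) \<longrightarrow> code_equiv q n A (star_anticode q t k n))"
    if n: "n \<ge> 2 * k + k * M" and A: "anticode q n (2 * (k - t)) k A" for n A
  proof -
    have sub: "A \<subseteq> const_weight_words q n k" and "A \<noteq> {}"
      using A by (auto simp: anticode_def const_weight_words_def)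
    then obtain x where x: "x \<in> A"
      by blast
    note xD = const_weight_wordsD[OF subsetD[OF sub x]]
    show ?thesis
    proof (cases "\<exists>T. T \<subseteq> supp x \<and> card T = t \<and> (\<forall>y\<in>A. \<forall>i\<in>T. y ! i = x ! i)")
      case True
      then obtain T where T: "T \<subseteq> supp x" "card T = t" "\<And>y i. y \<in> A \<Longrightarrow> i \<in> T \<Longrightarrow> y ! i = x ! i"
        by blast
      have "T \<subseteq> {..<n}"
        using T(1) xD(4) by blast
      moreover have "x ! i \<noteq> 0 \<and> x ! i < q" if "i \<in> T" for i
        using that T(1) xD(1,5) by (auto simp: supp_def)
      ultimately show ?thesis
        using code_equiv_if_common_values[of A q n k T t "(!) x"] sub T(2,3) assms by simp
    next
      case False
      have "card A \<le> 2 ^ k * (2 * k) * (((n - Suc t) choose (k - Suc t)) * q ^ k)"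
        using False by (intro card_le_if_no_common_values[OF sub x assms(2)]
            anticode_hamming_dist_le[OF A]) auto
      also have "\<dots> = M * ((n - Suc t) choose (k - Suc t))"
        by (simp add: M_def mult_ac)
      also have "\<dots> < (n - t) choose (k - t)"
        using n assms by (intro mult_binomial_less) auto
      also have "\<dots> \<le> card (star_anticode q t k n)"
        using n assms by (intro card_star_anticode_ge) auto
      finally show ?thesis
        by simp
    qed
  qed
  show ?thesis
  proof (rule exI, intro allI impI conjI)
    fix n assume "n \<ge> 2 * k + k * M"
    then show "anticode q n (2 * (k - t)) k (star_anticode q t k n)"
      using assms by (intro anticode_star_anticode) auto
  qed (use main in auto)
qed

end
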